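(* There is a constant $C>0$, independent of the mesh size $h$, of the location of the interface $\Gamma$ relative to the mesh, and of $\beta^\pm$, such that for each interface element $T\in\mathcal{T}_h^i$, $$\|\nabla\phi_T\|_{L^2(T)}\le C\,\frac{\beta^+}{\beta^-}\,h^{-1}\|\phi_T\|_{L^2(T)},\qquad \forall \phi_T\in S_h(T).$$
   Context: Setting and mesh: $\Omega\subset\mathbb{R}^3$ is an open cuboid, separated into two subdomains $\Omega^-$ and $\Omega^+$ by a closed $C^2$ surface $\Gamma\subset\Omega$ (the interface). The coefficient $\beta$ is piecewise constant, $\beta=\beta^\pm$ in $\Omega^\pm$, with $\beta^+\ge\beta^->0$. $\kappa$ is the maximal (principal) curvature of $\Gamma$, and $r_\Gamma$ (the reach) is the largest $r$ such that the segments $N_X(r)$, $X\in\Gamma$, of length $2r$, centered at $X$ and perpendicular to $\Gamma$, are pairwise disjoint. $\mathcal{T}_h$ is a Cartesian mesh of $\Omega$ consisting of cubes of edge length $h$. An element is an interface element if its vertices do not all lie on the same side of $\Gamma$; $\mathcal{T}_h^i$ is the set of interface elements. Standing assumptions: $h<r_\Gamma/(3\sqrt3)$; $h\kappa\le 0.0288$; $\Gamma$ meets each mesh edge in at most one point; $\Gamma$ meets at most two edges of each mesh face. Approximate plane: for each $T\in\mathcal{T}_h^i$, fix a triangle whose vertices are three of the intersection points of $\Gamma$ with the edges of $T$ and whose maximal angle is at most $135^\circ$ (such a triangle always exists). $\tau_T$ is the plane containing it, $\bar{\mathbf{n}}$ a unit normal to $\tau_T$, and $F_T$ the centroid of the triangle.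 Put $L(X)=(X-F_T)\cdot\bar{\mathbf{n}}$. Trilinear IFE space: $\mathbb{Q}_1=\mathrm{Span}\{1,x,y,z,xy,xz,yz,xyz\}$, $T^\pm=T\cap\Omega^\pm$, and $\mathcal{C}_T:\mathbb{Q}_1\to\mathbb{Q}_1$, $\mathcal{C}_T(p)=p+\left(\frac{\beta^-}{\beta^+}-1\right)(\nabla p(F_T)\cdot\bar{\mathbf{n}})L$. The local space $S_h(T)$ consists of the functions $\phi_T$ with $\phi_T|_{T^-}=p$ and $\phi_T|_{T^+}=\mathcal{C}_T(p)$ for some $p\in\mathbb{Q}_1$. The gradient $\nabla\phi_T$ is taken piecewise on $T^\pm$. The constant $C$ may depend on the fixed data $\Omega,\Gamma$. *)

theory Defs
  imports "HOL-Analysis.Analysis"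
begin

section \<open>Closed surfaces of class C2 in three-space\<close>

text \<open>A regular C2 parametrization of a relatively open piece of \<open>\<Gamma>\<close>, with its first and second
  derivatives \<open>D\<close> and \<open>D2\<close>: \<open>D2 u v w\<close> is the derivative of \<open>u \<mapsto> D u w\<close> in direction \<open>v\<close>.\<close>

definition C2_chart ::
    "(real^3) set \<Rightarrow> (real^2) set \<Rightarrow> (real^2 \<Rightarrow> real^3) \<Rightarrow> (real^2 \<Rightarrow> (real^2) \<Rightarrow>\<^sub>L (real^3))
      \<Rightarrow> (real^2 \<Rightarrow> (real^2) \<Rightarrow>\<^sub>L (real^2) \<Rightarrow>\<^sub>L (real^3)) \<Rightarrow> bool" where
  "C2_chart \<Gamma> U \<psi> D D2 \<longleftrightarrow>
     open U \<and> openin (top_of_set \<Gamma>) (\<psi> ` U) \<and> (\<exists>g. homeomorphism U (\<psi> ` U) \<psi> g) \<and>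
     (\<forall>u\<in>U. (\<psi> has_derivative blinfun_apply (D u)) (at u)) \<and>
     (\<forall>u\<in>U. (D has_derivative blinfun_apply (D2 u)) (at u)) \<and>
     continuous_on U D2 \<and>
     (\<forall>u\<in>U. inj (blinfun_apply (D u)))"

definition closed_C2_surface :: "(real^3) set \<Rightarrow> bool" where
  "closed_C2_surface \<Gamma> \<longleftrightarrow>
     compact \<Gamma> \<and> (\<forall>X\<in>\<Gamma>. \<exists>U \<psi> D D2. C2_chart \<Gamma> U \<psi> D D2 \<and> X \<in> \<psi> ` U)"

definition tangent_space :: "(real^3) set \<Rightarrow> real^3 \<Rightarrow> (real^3) set" where
  "tangent_space \<Gamma> X =
     {blinfun_apply (D u) v | U \<psi> D D2 u v. C2_chart \<Gamma> U \<psi> D D2 \<and> u \<in> U \<and> \<psi> u = X}"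

text \<open>\<open>k\<close> is an eigenvalue, with eigenvector \<open>v\<close>, of the second fundamental form
  \<open>II(v, w) = D2 u v w \<bullet> \<nu>\<close> relative to the first one \<open>I(v, w) = D u v \<bullet> D u w\<close>, i.e. an eigenvalue
  of the shape operator. The sign of \<open>k\<close> depends on the choice of the unit normal \<open>\<nu>\<close>;
  both choices are admitted.\<close>

definition principal_curvature :: "(real^3) set \<Rightarrow> real^3 \<Rightarrow> real \<Rightarrow> bool" where
  "principal_curvature \<Gamma> X k \<longleftrightarrow>
     (\<exists>U \<psi> D D2 u \<nu> v. C2_chart \<Gamma> U \<psi> D D2 \<and> u \<in> U \<and> \<psi> u = X \<and>
        norm \<nu> = 1 \<and> \<nu> \<in> (tangent_space \<Gamma> X)\<^sup>\<bottom> \<and> v \<noteq> 0 \<and>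
        (\<forall>w. blinfun_apply (blinfun_apply (D2 u) v) w \<bullet> \<nu>
              = k * (blinfun_apply (D u) v \<bullet> blinfun_apply (D u) w)))"

definition max_curvature :: "(real^3) set \<Rightarrow> real" where
  "max_curvature \<Gamma> = Sup {\<bar>k\<bar> | k X. X \<in> \<Gamma> \<and> principal_curvature \<Gamma> X k}"

definition normal_segment :: "(real^3) set \<Rightarrow> real \<Rightarrow> real^3 \<Rightarrow> (real^3) set" where
  "normal_segment \<Gamma> r X = {X + w | w. w \<in> (tangent_space \<Gamma> X)\<^sup>\<bottom> \<and> norm w \<le> r}"

text \<open>A supremum, because for closed segments the largest such \<open>r\<close> need not be attained (sphere).\<close>

definition reach :: "(real^3) set \<Rightarrow> real" where
  "reach \<Gamma> = Sup {r. 0 < r \<and> disjoint_family_on (normal_segment \<Gamma> r) \<Gamma>}"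

definition separates_into :: "(real^3) set \<Rightarrow> (real^3) set \<Rightarrow> (real^3) set \<Rightarrow> (real^3) set \<Rightarrow> bool" where
  "separates_into \<Gamma> \<Omega> \<Omega>m \<Omega>p \<longleftrightarrow>
     open \<Omega>m \<and> connected \<Omega>m \<and> \<Omega>m \<noteq> {} \<and>
     open \<Omega>p \<and> connected \<Omega>p \<and> \<Omega>p \<noteq> {} \<and>
     \<Omega>m \<inter> \<Omega>p = {} \<and> \<Omega>m \<union> \<Omega>p = \<Omega> - \<Gamma>"

section \<open>Cartesian mesh and interface elements\<close>

text \<open>The mesh exists only if \<open>h\<close> divides all side lengths of the cuboid.\<close>

definition cartesian_mesh :: "real^3 \<Rightarrow> real^3 \<Rightarrow> real \<Rightarrow> (real^3) set set \<Rightarrow> bool" where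
  "cartesian_mesh a b h \<T> \<longleftrightarrow>
     0 < h \<and> \<T> division_of cbox a b \<and>
     (\<forall>T\<in>\<T>. \<exists>k :: 3 \<Rightarrow> nat.
        T = cbox (\<chi> i. a $ i + h * real (k i)) (\<chi> i. a $ i + h * (real (k i) + 1)))"

definition mesh_assumptions :: "(real^3) set \<Rightarrow> real \<Rightarrow> (real^3) set set \<Rightarrow> bool" where
  "mesh_assumptions \<Gamma> h \<T> \<longleftrightarrow>
     h < reach \<Gamma> / (3 * sqrt 3) \<and>
     h * max_curvature \<Gamma> \<le> 0.0288 \<and>
     (\<forall>T\<in>\<T>. \<forall>e. e edge_of T \<longrightarrow> (\<forall>x\<in>\<Gamma> \<inter> e. \<forall>y\<in>\<Gamma> \<inter> e. x = y)) \<and>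
     (\<forall>T\<in>\<T>. \<forall>f. f facet_of T \<longrightarrow> card {e. e edge_of f \<and> \<Gamma> \<inter> e \<noteq> {}} \<le> 2)"

text \<open>Vertices may lie on the boundary of the cuboid, outside the open sets \<open>\<Omega>m\<close> and \<open>\<Omega>p\<close>. Hence
  the two sides of \<open>\<Gamma>\<close> in the closed cuboid are \<open>closure \<Omega>m - \<Gamma>\<close> and \<open>closure \<Omega>p - \<Gamma>\<close>; a vertex
  on \<open>\<Gamma>\<close> lies on neither side.\<close>

definition interface_element ::
    "(real^3) set \<Rightarrow> (real^3) set \<Rightarrow> (real^3) set \<Rightarrow> (real^3) set \<Rightarrow> bool" where
  "interface_element \<Gamma> \<Omega>m \<Omega>p T \<longleftrightarrow>
     \<not> {v. v extreme_point_of T} \<subseteq> closure \<Omega>m - \<Gamma> \<and>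
     \<not> {v. v extreme_point_of T} \<subseteq> closure \<Omega>p - \<Gamma>"

section \<open>Approximate plane\<close>

definition angle_at :: "real^3 \<Rightarrow> real^3 \<Rightarrow> real^3 \<Rightarrow> real" where
  "angle_at P Q R = arccos (((Q - P) \<bullet> (R - P)) / (norm (Q - P) * norm (R - P)))"

definition intersection_points :: "(real^3) set \<Rightarrow> (real^3) set \<Rightarrow> (real^3) set" where
  "intersection_points \<Gamma> T = \<Gamma> \<inter> \<Union>{e. e edge_of T}"

definition approx_triangle ::
    "(real^3) set \<Rightarrow> (real^3) set \<Rightarrow> real^3 \<Rightarrow> real^3 \<Rightarrow> real^3 \<Rightarrow> bool" where
  "approx_triangle \<Gamma> T P Q R \<longleftrightarrow>
     {P, Q, R} \<subseteq> intersection_points \<Gamma> T \<and> \<not> collinear {P, Q, R} \<and>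
     angle_at P Q R \<le> 3 * pi / 4 \<and> angle_at Q R P \<le> 3 * pi / 4 \<and> angle_at R P Q \<le> 3 * pi / 4"

definition centroid :: "real^3 \<Rightarrow> real^3 \<Rightarrow> real^3 \<Rightarrow> real^3" where
  "centroid P Q R = (1/3) *\<^sub>R (P + Q + R)"

definition plane_unit_normal :: "(real^3) set \<Rightarrow> real^3 \<Rightarrow> bool" where
  "plane_unit_normal \<tau> n \<longleftrightarrow> norm n = 1 \<and> (\<forall>x\<in>\<tau>. \<forall>y\<in>\<tau>. orthogonal n (x - y))"

section \<open>Local immersed finite element space\<close>

definition grad :: "(real^3 \<Rightarrow> real) \<Rightarrow> real^3 \<Rightarrow> real^3" where
  "grad f x = (THE D. GDERIV f x :> D)"

text \<open>The eight monomials 1, x, y, z, xy, xz, yz, xyz are indexed by the subsets of the three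
  coordinate directions.\<close>

definition Q1 :: "(real^3 \<Rightarrow> real) set" where
  "Q1 = {p. \<exists>c :: 3 set \<Rightarrow> real. \<forall>x. p x = (\<Sum>I\<in>UNIV. c I * (\<Prod>i\<in>I. x $ i))}"

definition ife_extension ::
    "real \<Rightarrow> real \<Rightarrow> real^3 \<Rightarrow> real^3 \<Rightarrow> (real^3 \<Rightarrow> real) \<Rightarrow> real^3 \<Rightarrow> real" where
  "ife_extension \<beta>m \<beta>p F n p = (\<lambda>x. p x + (\<beta>m / \<beta>p - 1) * (grad p F \<bullet> n) * ((x - F) \<bullet> n))"

text \<open>Functions are considered up to their values off \<open>(T \<inter> \<Omega>m) \<union> (T \<inter> \<Omega>p)\<close>, which leaves only a
  null set of \<open>T\<close>, namely points of the interface or of the boundary of the cuboid.\<close>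

definition ife_space ::
    "(real^3) set \<Rightarrow> (real^3) set \<Rightarrow> real \<Rightarrow> real \<Rightarrow> (real^3) set \<Rightarrow> real^3 \<Rightarrow> real^3
      \<Rightarrow> (real^3 \<Rightarrow> real) set" where
  "ife_space \<Omega>m \<Omega>p \<beta>m \<beta>p T F n =
     {\<phi>. \<exists>p\<in>Q1. (\<forall>x\<in>T \<inter> \<Omega>m. \<phi> x = p x) \<and> (\<forall>x\<in>T \<inter> \<Omega>p. \<phi> x = ife_extension \<beta>m \<beta>p F n p x)}"

text \<open>For \<open>\<phi>\<close> in \<open>ife_space\<close> the pointwise gradient \<open>grad \<phi>\<close> is the piecewise gradient: \<open>\<phi>\<close> is a
  polynomial on each of the open sets \<open>interior T \<inter> \<Omega>m\<close> and \<open>interior T \<inter> \<Omega>p\<close>, whose union is \<open>T\<close>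
  up to a null set. The complete measure \<open>lebesgue\<close> ignores the arbitrary values on that null set.\<close>

definition L2_norm_on :: "(real^3) set \<Rightarrow> (real^3 \<Rightarrow> 'b::real_normed_vector) \<Rightarrow> real" where
  "L2_norm_on T f = sqrt (LINT x:T|lebesgue. (norm (f x))\<^sup>2)"

end

theory Submission
  imports Defs
begin

text \<open>
  The interface \<open>\<Gamma>\<close> is a null set, so the two parts \<open>T \<inter> \<Omega>m\<close> and \<open>T \<inter> \<Omega>p\<close> of an element \<open>T\<close>
  together have its full volume \<open>h\<^sup>3\<close>, and one of them, say \<open>S\<close>, has volume at least \<open>h\<^sup>3 / 2\<close>.
  On \<open>S\<close> the function \<open>\<phi>\<close> is one trilinear polynomial \<open>u\<close>. The proof controls \<open>u\<close>
  on all of \<open>T\<close> by its values on \<open>S\<close>, and then the polynomial on the other side by \<open>u\<close>.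

  The first step is an inequality of Remez type. A function that is affine in each variable can be
  small, compared with its value at a point \<open>v\<close>, only on a small part of the cube. To see this,
  move from \<open>v\<close> to a generic point \<open>x\<close> by changing one coordinate at a time. If the value is small
  at \<open>x\<close>, then in one of these moves it drops by a factor of at least \<open>100\<close>. The points where the move in
  direction \<open>i\<close> causes such a drop form a set that meets each line in direction \<open>i\<close> in a set of
  small diameter (\<open>affine_small_values_close\<close>), and such a set has small volume because
  many of its translates are disjoint and fit into a box of volume \<open>2 h\<^sup>3\<close>
  (\<open>measure_thin_in_direction\<close>). Altogether the exceptional set has volume at most \<open>h\<^sup>3 / 4\<close>
  (\<open>measure_sublevel_multiaffine\<close>), so at least \<open>h\<^sup>3 / 4\<close> of \<open>S\<close> remains. Hence the maximum \<open>M\<close> of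
  \<open>\<bar>u\<bar>\<close> over \<open>T\<close> is at most a constant times \<open>h\<^sup>-\<^sup>3\<^sup>/\<^sup>2\<close> times the \<open>L\<^sup>2\<close> norm of \<open>\<phi>\<close>
  (\<open>multiaffine_L2_lower_bound\<close>). Since \<open>u\<close> is affine along each edge direction, its
  partial derivatives are difference quotients over the length \<open>h\<close>, hence at most \<open>2 M / h\<close>
  (\<open>norm_gradient_le\<close>).

  The second step uses the form of the extension: the gradients on the two sides differ by the
  constant vector \<open>k (\<nabla>u(F) \<bullet> n) n\<close>. If \<open>S\<close> lies in \<open>\<Omega>m\<close>, then \<open>k = \<beta>m / \<beta>p - 1\<close>. If it lies in
  \<open>\<Omega>p\<close>, the extension has to be inverted; it scales the normal derivative at \<open>F\<close> by \<open>\<beta>m / \<beta>p\<close>,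
  so its inverse has the same form with \<open>k = \<beta>p / \<beta>m - 1\<close>. In both cases \<open>\<bar>k\<bar> \<le> \<beta>p / \<beta>m\<close>,
  which is the origin of this factor in the estimate
  (\<open>inverse_inequality_from_large_part\<close>).
\<close>

section \<open>Functions that are affine in each variable\<close>

definition multiaffine :: "(real^'n \<Rightarrow> real) \<Rightarrow> bool" where
  "multiaffine p \<longleftrightarrow> continuous_on UNIV p \<and>
     (\<forall>x i. \<exists>c. \<forall>t. p (x + t *\<^sub>R axis i 1) = p x + t * c)"

abbreviation cube :: "real^'n \<Rightarrow> real \<Rightarrow> (real^'n) set" where
  "cube A h \<equiv> cbox A (A + (\<chi> i. h))"

lemma measure_cube:
  fixes A :: "real^'n"
  assumes "0 < h"
  shows "measure lebesgue (cube A h) = h ^ CARD('n)"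
proof -
  have "A \<in> cube A h"
    using assms by (simp add: mem_box_cart)
  then have "measure lborel (cube A h) = h ^ CARD('n)"
    by (subst content_cbox_cart) auto
  then show ?thesis by simp
qed

section \<open>Sublevel sets in a cube\<close>

text \<open>The \<open>N\<close> translates of \<open>B\<close> by the multiples \<open>0, \<dots>, N - 1\<close> of \<open>h / N\<close> in direction \<open>i\<close> are
  disjoint, because two points of \<open>B\<close> on a line in that direction are less than \<open>h / N\<close> apart. They
  all lie in the cube extended by \<open>h\<close> in direction \<open>i\<close>, whose volume is twice that of the cube.
  This replaces an integration over the lines.\<close>

lemma measure_thin_in_direction:
  fixes A :: "real^'n"
  assumes h: "0 < h" and N: "0 < N" and BT: "B \<subseteq> cube A h" and B: "B \<in> lmeasurable"
    and thin: "\<And>x t. x \<in> B \<Longrightarrow> x + t *\<^sub>R axis i 1 \<in> B \<Longrightarrow> \<bar>t\<bar> < h / real N"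
  shows "measure lebesgue B \<le> 2 * h ^ CARD('n) / real N"
proof -
  define s where "s k = (real k * (h / real N)) *\<^sub>R (axis i 1 :: real^'n)" for k
  define D where "D = cbox A (A + (\<chi> j. h) + h *\<^sub>R axis i 1)"
  have disj: "disjoint_family_on (\<lambda>k. (+) (s k) ` B) {..<N}"
    unfolding disjoint_family_on_def
  proof (intro ballI impI equals0I)
    fix k l z assume kl: "k \<noteq> l" and z: "z \<in> (+) (s k) ` B \<inter> (+) (s l) ` B"
    then obtain x y where xy: "x \<in> B" "y \<in> B" "s k + x = s l + y" by auto
    then have "y = x + ((real k - real l) * (h / real N)) *\<^sub>R axis i 1"
      by (simp add: s_def algebra_simps)
    then have "\<bar>(real k - real l) * (h / real N)\<bar> < h / real N"
      using thin xy by metis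
    then have "\<bar>real k - real l\<bar> * (h / real N) < 1 * (h / real N)"
      using h by (simp add: abs_mult)
    then have "\<bar>real k - real l\<bar> < 1"
      using h N by (simp only: mult_less_cancel_right_pos divide_pos_pos of_nat_0_less_iff)
    then show False using kl by linarith
  qed
  have sub: "(\<Union>k<N. (+) (s k) ` B) \<subseteq> D"
  proof
    fix z assume "z \<in> (\<Union>k<N. (+) (s k) ` B)"
    then obtain k x where k: "k < N" and x: "x \<in> B" and z: "z = s k + x" by auto
    have "0 \<le> real k * (h / real N)" "real k * (h / real N) \<le> h"
      using k h by (auto simp: field_simps)
    then have s: "0 \<le> s k $ j" "s k $ j \<le> (h *\<^sub>R axis i 1 :: real^'n) $ j" for j
      by (simp_all add: s_def axis_def)
    have "A $ j \<le> x $ j \<and> x $ j \<le> A $ j + h" for j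
      using BT x by (auto simp: mem_box_cart)
    then have "A $ j \<le> s k $ j + x $ j
        \<and> s k $ j + x $ j \<le> A $ j + h + (h *\<^sub>R axis i 1 :: real^'n) $ j" for j
      using s[of j] by (smt (verit, best))
    then show "z \<in> D"
      by (simp add: D_def mem_box_cart z)
  qed
  have "measure lebesgue D = 2 * h ^ CARD('n)"
  proof -
    have "A \<in> D"
      using h by (simp add: D_def mem_box_cart axis_def)
    then have "measure lborel D = (\<Prod>j\<in>UNIV. h + (if j = i then h else 0))"
      unfolding D_def by (subst content_cbox_cart) (auto simp: axis_def intro!: prod.cong)
    also have "\<dots> = 2 * h * (\<Prod>j\<in>UNIV - {i}. h)"
      by (subst prod.remove[of _ i]) auto
    also have "\<dots> = 2 * (\<Prod>j\<in>(UNIV :: 'n set). h)"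
      by (subst (2) prod.remove[of _ i]) auto
    finally show ?thesis by (simp add: D_def)
  qed
  moreover have "measure lebesgue (\<Union>k<N. (+) (s k) ` B) \<le> measure lebesgue D"
    using sub by (intro measure_mono_fmeasurable)
      (auto simp: D_def intro!: sets.finite_UN fmeasurableD measurable_translation B)
  moreover have "measure lebesgue (\<Union>k<N. (+) (s k) ` B) = real N * measure lebesgue B"
  proof (subst measure_finite_Union)
    show "(\<lambda>k. (+) (s k) ` B) ` {..<N} \<subseteq> sets lebesgue"
      by (auto simp: B fmeasurableD measurable_translation)
    show "emeasure lebesgue ((+) (s k) ` B) \<noteq> \<infinity>" for k
      using measurable_translation[OF B] fmeasurableD2 by fastforce
  qed (simp_all add: disj measure_translation)
  ultimately show ?thesis
    using N by (simp add: field_simps)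
qed

text \<open>An affine function that drops from \<open>f s\<close> to a hundredth of it within distance \<open>h\<close> has a slope
  of at least \<open>99/100 \<bar>f s\<bar> / h\<close>, so it leaves the interval of small values after a distance of at
  most \<open>2/99 h\<close>. The bound \<open>h / 24\<close> suits the twenty-four translates used later.\<close>

lemma affine_small_values_close:
  fixes f :: "real \<Rightarrow> real"
  assumes f: "\<And>t. f t = f s + (t - s) * c" and nz: "f s \<noteq> 0"
    and small: "\<bar>f t1\<bar> \<le> \<bar>f s\<bar> / 100" "\<bar>f t2\<bar> \<le> \<bar>f s\<bar> / 100"
    and close: "\<bar>t1 - s\<bar> \<le> h" and h: "0 < h"
  shows "\<bar>t1 - t2\<bar> < h / 24"
proof -
  let ?m = "\<bar>f s\<bar>"
  have "\<bar>t1 - s\<bar> * \<bar>c\<bar> \<le> h * \<bar>c\<bar>"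
    using close by (intro mult_right_mono) auto
  then have "\<bar>f t1 - f s\<bar> \<le> h * \<bar>c\<bar>"
    using f[of t1] by (simp add: abs_mult)
  then have steep: "99 / 100 * ?m \<le> h * \<bar>c\<bar>"
    using small(1) by linarith
  have "\<bar>t1 - t2\<bar> * \<bar>c\<bar> = \<bar>f t1 - f t2\<bar>"
    unfolding f[of t1] f[of t2] by (simp add: abs_mult[symmetric] algebra_simps)
  also have "\<dots> \<le> 2 / 100 * ?m"
    using small by linarith
  finally have "\<bar>t1 - t2\<bar> * \<bar>c\<bar> \<le> 2 / 100 * ?m" .
  also have "\<dots> < 1 / 24 * (99 / 100 * ?m)"
    using nz by simp
  also have "\<dots> \<le> 1 / 24 * (h * \<bar>c\<bar>)"
    using steep by simp
  finally have "\<bar>t1 - t2\<bar> * \<bar>c\<bar> < (h / 24) * \<bar>c\<bar>" by simp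
  then show ?thesis
    by (rule mult_right_less_imp_less) simp
qed

text \<open>Releasing the coordinates in \<open>J\<close> one after the other leads from the reference point \<open>v\<close>
  (\<open>J = {}\<close>) to \<open>x\<close> (\<open>J = UNIV\<close>) along segments parallel to the axes.\<close>

definition released :: "'n set \<Rightarrow> real^'n \<Rightarrow> real^'n \<Rightarrow> real^'n" where
  "released J v x = (\<chi> j. if j \<in> J then x $ j else v $ j)"

lemma continuous_on_released: "continuous_on UNIV (released J v)"
proof -
  have "continuous_on UNIV (\<lambda>x. if j \<in> J then x $ j else v $ j)" for j
    by (cases "j \<in> J") (auto intro!: continuous_intros)
  then show ?thesis
    unfolding released_def by (rule continuous_on_vec_lambda)
qed

text \<open>Each released coordinate may reduce the value by a factor \<open>100\<close>, at the cost of an exceptional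
  set of volume at most a twelfth of the volume of the cube.\<close>

lemma measure_sublevel_released:
  fixes p :: "real^'n \<Rightarrow> real"
  assumes p: "multiaffine p" and h: "0 < h" and v: "v \<in> cube A h" and pv: "p v \<noteq> 0"
  shows "measure lebesgue {x \<in> cube A h. \<bar>p (released J v x)\<bar> < (1/100) ^ card J * \<bar>p v\<bar>}
           \<le> real (card J) * h ^ CARD('n) / 12"
proof (induction J rule: finite_induct[OF finite])
  case 1
  have "released {} v x = v" for x
    by (simp add: released_def vec_eq_iff)
  then show ?case using pv by simp
next
  case (2 i J)
  have cont: "continuous_on UNIV (\<lambda>x. p (released K v x))" for K
    using continuous_on_compose2[OF _ continuous_on_released, of UNIV p K v] p
    by (auto simp: multiaffine_def)
  have [measurable]: "(\<lambda>x. p (released K v x)) \<in> borel_measurable borel" for K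
    by (rule borel_measurable_continuous_onI[OF cont])
  have lm: "S \<in> lmeasurable" if "S \<in> sets borel" "S \<subseteq> cube A h" for S
    using that by (intro bounded_set_imp_lmeasurable)
      (auto intro: bounded_subset bounded_cbox simp: sets_completionI_sets)
  let ?E = "\<lambda>K. {x \<in> cube A h. \<bar>p (released K v x)\<bar> < (1/100) ^ card K * \<bar>p v\<bar>}"
  have E: "?E K \<in> lmeasurable" for K
    by (rule lm) auto
  \<comment> \<open>the points where releasing coordinate \<open>i\<close> is responsible for the drop\<close>
  define B where "B = {x \<in> cube A h. p (released J v x) \<noteq> 0 \<and>
      \<bar>p (released (insert i J) v x)\<bar> \<le> \<bar>p (released J v x)\<bar> / 100}"
  have B: "B \<in> lmeasurable"
    unfolding B_def by (rule lm) auto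
  have "measure lebesgue B \<le> 2 * h ^ CARD('n) / real 24"
  proof (rule measure_thin_in_direction[OF h _ _ B])
    fix x t assume x: "x \<in> B" and xt: "x + t *\<^sub>R axis i 1 \<in> B"
    \<comment> \<open>\<open>x\<close> and \<open>?y\<close> share the base point \<open>?b\<close>, so both drops concern the same affine function\<close>
    let ?y = "x + t *\<^sub>R axis i 1"
    let ?b = "released J v x"
    obtain c where c: "p (?b + r *\<^sub>R axis i 1) = p ?b + r * c" for r
      using p unfolding multiaffine_def by meson
    define f where "f r = p (?b + (r - v $ i) *\<^sub>R axis i 1)" for r
    have base: "released J v ?y = ?b"
      using \<open>i \<notin> J\<close> by (auto simp: released_def vec_eq_iff axis_def)
    have "released (insert i J) v x = ?b + (x $ i - v $ i) *\<^sub>R axis i 1"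
         "released (insert i J) v ?y = ?b + (x $ i + t - v $ i) *\<^sub>R axis i 1"
      using \<open>i \<notin> J\<close> by (auto simp: released_def vec_eq_iff axis_def)
    then have f: "f (x $ i) = p (released (insert i J) v x)"
      "f (x $ i + t) = p (released (insert i J) v ?y)" "f (v $ i) = p ?b"
      by (simp_all add: f_def)
    have bnd: "A $ i \<le> x $ i" "x $ i \<le> A $ i + h" "A $ i \<le> v $ i" "v $ i \<le> A $ i + h"
      using x v by (auto simp: B_def mem_box_cart)
    have "\<bar>x $ i - (x $ i + t)\<bar> < h / 24"
    proof (rule affine_small_values_close[of f "v $ i" c])
      show "f r = f (v $ i) + (r - v $ i) * c" for r
        by (simp add: f_def c)
    qed (use x xt base f bnd h in \<open>auto simp: B_def\<close>)
    then show "\<bar>t\<bar> < h / real 24" by simp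
  qed (auto simp: B_def)
  moreover have "?E (insert i J) \<subseteq> ?E J \<union> B"
  proof clarify
    fix x assume x: "x \<in> cube A h" "x \<notin> B"
      and le: "\<bar>p (released (insert i J) v x)\<bar> < (1/100) ^ card (insert i J) * \<bar>p v\<bar>"
    show "\<bar>p (released J v x)\<bar> < (1/100) ^ card J * \<bar>p v\<bar>"
    proof (rule ccontr)
      assume gt: "\<not> ?thesis"
      moreover have "0 < (1/100) ^ card J * \<bar>p v\<bar>"
        using pv by simp
      ultimately have "p (released J v x) \<noteq> 0" by auto
      with le gt x show False
        using 2 by (auto simp: B_def)
    qed
  qed
  then have "measure lebesgue (?E (insert i J)) \<le> measure lebesgue (?E J \<union> B)"
    using E B by (intro measure_mono_fmeasurable fmeasurable.Un) (auto dest: fmeasurableD)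
  moreover have "measure lebesgue (?E J \<union> B) \<le> measure lebesgue (?E J) + measure lebesgue B"
    using E B by (intro measure_Un_le fmeasurableD)
  ultimately have "measure lebesgue (?E (insert i J))
      \<le> real (card J) * h ^ CARD('n) / 12 + 2 * h ^ CARD('n) / real 24"
    using "2.IH" by linarith
  also have "\<dots> = real (card (insert i J)) * h ^ CARD('n) / 12"
    using \<open>i \<notin> J\<close> by (simp add: algebra_simps add_divide_distrib)
  finally show ?case .
qed

lemma measure_sublevel_multiaffine:
  fixes p :: "real^'n \<Rightarrow> real"
  assumes "multiaffine p" and "0 < h" and "v \<in> cube A h" and "p v \<noteq> 0"
  shows "measure lebesgue {x \<in> cube A h. \<bar>p x\<bar> < (1/100) ^ CARD('n) * \<bar>p v\<bar>}
           \<le> real CARD('n) * h ^ CARD('n) / 12"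
proof -
  have "released UNIV v x = x" for x
    by (simp add: released_def vec_eq_iff)
  then show ?thesis
    using measure_sublevel_released[OF assms, of UNIV] by simp
qed

section \<open>Gradients\<close>

lemma GDERIV_axis_slope:
  fixes p :: "real^'n \<Rightarrow> real"
  assumes D: "GDERIV p x :> D" and c: "\<And>t. p (x + t *\<^sub>R axis i 1) = p x + t * c"
  shows "D $ i = c"
proof -
  have "((\<lambda>t. x + t *\<^sub>R axis i 1) has_derivative (\<lambda>t. t *\<^sub>R axis i 1)) (at 0)"
    by (auto intro!: derivative_eq_intros)
  moreover have "(p has_derivative (\<lambda>h. h \<bullet> D)) (at (x + 0 *\<^sub>R axis i 1))"
    using D by (simp add: gderiv_def)
  ultimately have
    "((\<lambda>t. p (x + t *\<^sub>R axis i 1)) has_derivative (\<lambda>t. (t *\<^sub>R axis i 1) \<bullet> D)) (at 0)"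
    by (rule has_derivative_compose)
  moreover have "(\<lambda>t. (t *\<^sub>R axis i 1) \<bullet> D) = (\<lambda>t. t * D $ i)"
    by (simp add: inner_axis' fun_eq_iff)
  ultimately have "((\<lambda>t. p x + t * c) has_real_derivative D $ i) (at 0)"
    by (simp add: c has_field_derivative_def mult_commute_abs)
  moreover have "((\<lambda>t. p x + t * c) has_real_derivative c) (at 0)"
    by (auto intro!: derivative_eq_intros)
  ultimately show ?thesis by (rule DERIV_unique)
qed

text \<open>Along a line in direction \<open>i\<close> the function is affine, so its partial derivative is the
  difference quotient between the two opposite faces of the cube, where the function is bounded
  by \<open>M\<close>.\<close>

lemma norm_gradient_le:
  fixes p :: "real^'n \<Rightarrow> real"
  assumes p: "multiaffine p" and h: "0 < h" and x: "x \<in> cube A h" and D: "GDERIV p x :> D"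
    and M: "\<And>y. y \<in> cube A h \<Longrightarrow> \<bar>p y\<bar> \<le> M"
  shows "norm D \<le> real CARD('n) * (2 * M / h)"
proof -
  have comp: "\<bar>D $ i\<bar> \<le> 2 * M / h" for i
  proof -
    obtain c where c: "p (x + t *\<^sub>R axis i 1) = p x + t * c" for t
      using p unfolding multiaffine_def by meson
    let ?l = "x + (A $ i - x $ i) *\<^sub>R axis i 1" and ?r = "x + (A $ i + h - x $ i) *\<^sub>R axis i 1"
    have "?l \<in> cube A h" "?r \<in> cube A h"
      using x h by (auto simp: mem_box_cart axis_def)
    then have "\<bar>p ?l\<bar> \<le> M" "\<bar>p ?r\<bar> \<le> M"
      using M by blast+
    then have "\<bar>p ?r - p ?l\<bar> \<le> 2 * M" by linarith
    moreover have "p ?r - p ?l = h * c"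
      unfolding c by (simp add: algebra_simps)
    ultimately have "h * \<bar>c\<bar> \<le> 2 * M"
      using h by (simp add: abs_mult)
    moreover have "D $ i = c"
      by (rule GDERIV_axis_slope[OF D c])
    ultimately show ?thesis
      using h by (simp add: field_simps)
  qed
  have "norm D \<le> (\<Sum>i\<in>UNIV. \<bar>D $ i\<bar>)"
    by (rule norm_le_l1_cart)
  also have "\<dots> \<le> (\<Sum>i\<in>(UNIV :: 'n set). 2 * M / h)"
    by (intro sum_mono comp)
  finally show ?thesis by simp
qed

lemma gradient_of_affine_perturbation:
  assumes "GDERIV p x :> D"
  shows "GDERIV (\<lambda>y. p y + k * ((y - F) \<bullet> n)) x :> D + k *\<^sub>R n"
  using assms unfolding gderiv_def
  by (auto intro!: derivative_eq_intros simp: fun_eq_iff inner_add_right)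

lemma multiaffine_affine_perturbation:
  assumes p: "multiaffine p"
  shows "multiaffine (\<lambda>x. p x + k * ((x - F) \<bullet> n))"
  unfolding multiaffine_def
proof (intro conjI allI)
  show "continuous_on UNIV (\<lambda>x. p x + k * ((x - F) \<bullet> n))"
    using p unfolding multiaffine_def by (auto intro!: continuous_intros)
  fix x i
  obtain c where c: "p (x + t *\<^sub>R axis i 1) = p x + t * c" for t
    using p unfolding multiaffine_def by meson
  have "p (x + t *\<^sub>R axis i 1) + k * ((x + t *\<^sub>R axis i 1 - F) \<bullet> n)
      = p x + k * ((x - F) \<bullet> n) + t * (c + k * (axis i 1 \<bullet> n))" for t
    unfolding c by (simp add: inner_add_left inner_diff_left algebra_simps)
  then show "\<exists>c. \<forall>t. p (x + t *\<^sub>R axis i 1) + k * ((x + t *\<^sub>R axis i 1 - F) \<bullet> n)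
      = p x + k * ((x - F) \<bullet> n) + t * c" by blast
qed

lemma grad_eqI:
  assumes "GDERIV f x :> D"
  shows "grad f x = D"
  unfolding grad_def
proof (rule the_equality)
  show "GDERIV f x :> D" by (rule assms)
  fix E assume "GDERIV f x :> E"
  then have "(\<lambda>h. h \<bullet> E) = (\<lambda>h. h \<bullet> D)"
    using assms unfolding gderiv_def by (rule has_derivative_unique)
  then show "E = D"
    by (simp only: fun_eq_iff vector_eq_ldot)
qed

lemma Q1_GDERIV:
  assumes "p \<in> Q1"
  shows "GDERIV p x :> grad p x"
proof -
  obtain c where c: "p x = (\<Sum>I\<in>UNIV. c I * (\<Prod>i\<in>I. x $ i))" for x
    using assms unfolding Q1_def by blast
  have eq: "p = (\<lambda>x. \<Sum>I\<in>UNIV. c I * (\<Prod>i\<in>I. x $ i))"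
    using c by (rule ext)
  have "((\<lambda>x. \<Prod>i\<in>I. x $ i) has_derivative
      (\<lambda>y. \<Sum>i\<in>I. y $ i * (\<Prod>j\<in>I - {i}. x $ j))) (at x)" for I
    by (intro has_derivative_prod bounded_linear_imp_has_derivative bounded_linear_vec_nth)
  then have "((\<lambda>x. \<Sum>I\<in>UNIV. c I * (\<Prod>i\<in>I. x $ i)) has_derivative
      (\<lambda>y. \<Sum>I\<in>UNIV. c I * (\<Sum>i\<in>I. y $ i * (\<Prod>j\<in>I - {i}. x $ j)))) (at x)"
    by (intro has_derivative_sum has_derivative_mult_right)
  then obtain L where L: "(p has_derivative L) (at x)"
    unfolding eq[symmetric] by (rule that)
  define D where "D = (\<Sum>b\<in>Basis. L b *\<^sub>R b)"
  have "linear L"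
    using L by (rule has_derivative_linear)
  have "(\<lambda>h. h \<bullet> D) = L"
  proof
    fix h
    have "L h = L (\<Sum>b\<in>Basis. (h \<bullet> b) *\<^sub>R b)"
      by (simp only: euclidean_representation)
    also have "\<dots> = (\<Sum>b\<in>Basis. (h \<bullet> b) *\<^sub>R L b)"
      by (simp only: linear_sum[OF \<open>linear L\<close>] linear_scale[OF \<open>linear L\<close>])
    also have "\<dots> = h \<bullet> D"
      by (simp only: D_def inner_sum_right inner_scaleR_right real_scaleR_def mult.commute)
    finally show "h \<bullet> D = L h" by (rule sym)
  qed
  then have D: "GDERIV p x :> D"
    using L by (simp only: gderiv_def)
  then show ?thesis
    by (simp only: grad_eqI[OF D])
qed

lemma Q1_multiaffine:
  assumes "p \<in> Q1"
  shows "multiaffine p"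
  unfolding multiaffine_def
proof (intro conjI allI)
  show "continuous_on UNIV p"
    using has_derivative_continuous[OF Q1_GDERIV[OF assms, unfolded gderiv_def]]
    by (intro continuous_at_imp_continuous_on ballI)
  obtain c where c: "p x = (\<Sum>I\<in>UNIV. c I * (\<Prod>i\<in>I. x $ i))" for x
    using assms unfolding Q1_def by blast
  fix x :: "real^3" and i :: 3
  define s where "s I = (if i \<in> I then c I * (\<Prod>j\<in>I - {i}. x $ j) else 0)" for I
  have mono: "c I * (\<Prod>j\<in>I. (x + t *\<^sub>R axis i 1) $ j) = c I * (\<Prod>j\<in>I. x $ j) + t * s I" for t I
  proof (cases "i \<in> I")
    case True
    have "(\<Prod>j\<in>I. (x + t *\<^sub>R axis i 1) $ j) = (x $ i + t) * (\<Prod>j\<in>I - {i}. x $ j)"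
      using True by (subst prod.remove[of I i]) (auto simp: axis_def intro!: prod.cong)
    moreover have "(\<Prod>j\<in>I. x $ j) = x $ i * (\<Prod>j\<in>I - {i}. x $ j)"
      using True by (subst prod.remove[of I i]) auto
    ultimately show ?thesis
      using True by (simp add: s_def algebra_simps)
  next
    case False
    then have "(\<Prod>j\<in>I. (x + t *\<^sub>R axis i 1) $ j) = (\<Prod>j\<in>I. x $ j)"
      by (intro prod.cong) (auto simp: axis_def)
    then show ?thesis
      using False by (simp add: s_def)
  qed
  show "\<exists>c. \<forall>t. p (x + t *\<^sub>R axis i 1) = p x + t * c"
  proof (intro exI allI)
    show "p (x + t *\<^sub>R axis i 1) = p x + t * (\<Sum>I\<in>UNIV. s I)" for t
      unfolding c mono by (simp only: sum.distrib sum_distrib_left)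
  qed
qed

section \<open>The inverse inequality on one element\<close>

text \<open>Half of the cube is in \<open>S\<close> and at most a quarter belongs to the sublevel set at height
  \<open>10\<^sup>-\<^sup>6 \<bar>p x\<bar>\<close>. Hence \<open>\<phi>\<^sup>2\<close> is at least \<open>10\<^sup>-\<^sup>1\<^sup>2 (p x)\<^sup>2\<close> on a set of volume \<open>h\<^sup>3 / 4\<close>, and the
  constant is \<open>2 \<sqdot> 10\<^sup>6\<close>.\<close>

lemma multiaffine_L2_lower_bound:
  fixes p :: "real^3 \<Rightarrow> real"
  assumes p: "multiaffine p" and h: "0 < h" and S: "S \<in> sets lebesgue" "S \<subseteq> cube A h"
    and half: "h ^ 3 / 2 \<le> measure lebesgue S" and eq: "\<And>x. x \<in> S \<Longrightarrow> \<phi> x = p x"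
    and int: "set_integrable lebesgue (cube A h) (\<lambda>x. (\<phi> x)\<^sup>2)"
    and x: "x \<in> cube A h"
  shows "\<bar>p x\<bar> * sqrt (h ^ 3) \<le> 2000000 * L2_norm_on (cube A h) \<phi>"
proof (cases "p x = 0")
  case True
  then show ?thesis
    by (simp add: L2_norm_on_def set_lebesgue_integral_def integral_nonneg_AE)
next
  case False
  let ?T = "cube A h"
  define e where "e = (1/100) ^ 3 * \<bar>p x\<bar>"
  define E where "E = {y \<in> ?T. \<bar>p y\<bar> < e}"
  have small: "measure lebesgue E \<le> h ^ 3 / 4"
    using measure_sublevel_multiaffine[OF p h x False] by (simp add: E_def e_def)
  have "continuous_on UNIV p"
    using p by (simp add: multiaffine_def)
  then have [measurable]: "p \<in> borel_measurable borel"
    by (rule borel_measurable_continuous_onI)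
  have "E \<in> sets borel" unfolding E_def by measurable
  then have Eb: "E \<in> sets lebesgue"
    by (simp add: sets_completionI_sets)
  have lm: "X \<in> lmeasurable" if "X \<in> sets lebesgue" "X \<subseteq> ?T" for X
    by (rule bounded_set_imp_lmeasurable[OF bounded_subset[OF bounded_cbox that(2)] that(1)])
  have Slm: "S \<in> lmeasurable"
    by (rule lm[OF S])
  have Elm: "E \<in> lmeasurable"
    by (rule lm[OF Eb]) (auto simp: E_def)
  have D: "S - E \<in> lmeasurable"
    using Slm Eb by (rule fmeasurable_Diff)
  have "measure lebesgue S \<le> measure lebesgue ((S - E) \<union> E)"
    using S D Elm by (intro measure_mono_fmeasurable fmeasurable.Un) auto
  also have "\<dots> \<le> measure lebesgue (S - E) + measure lebesgue E"
    using D Elm by (intro measure_Un_le fmeasurableD)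
  finally have large: "h ^ 3 / 4 \<le> measure lebesgue (S - E)"
    using half small by simp
  have "e\<^sup>2 * (h ^ 3 / 4) \<le> e\<^sup>2 * measure lebesgue (S - E)"
    using large by (intro mult_left_mono) auto
  also have "\<dots> = (LINT y|lebesgue. indicator (S - E) y * e\<^sup>2)"
    using D by (simp add: fmeasurable_def)
  also have "\<dots> \<le> (LINT y|lebesgue. indicator ?T y *\<^sub>R (\<phi> y)\<^sup>2)"
  proof (rule integral_mono)
    show "integrable lebesgue (\<lambda>y. indicator (S - E) y * e\<^sup>2)"
      using D by (simp add: lmeasurable_iff_integrable)
    show "integrable lebesgue (\<lambda>y. indicator ?T y *\<^sub>R (\<phi> y)\<^sup>2)"
      using int by (simp add: set_integrable_def)
    fix y
    show "indicator (S - E) y * e\<^sup>2 \<le> indicator ?T y *\<^sub>R (\<phi> y)\<^sup>2"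
    proof (cases "y \<in> S - E")
      case True
      then have y: "y \<in> ?T" "e \<le> \<bar>p y\<bar>"
        using S by (auto simp: E_def)
      moreover have "0 \<le> e"
        by (simp add: e_def)
      ultimately have "e\<^sup>2 \<le> (p y)\<^sup>2"
        by (intro abs_le_square_iff[THEN iffD1]) simp
      then show ?thesis
        using True y eq by simp
    qed simp
  qed
  also have "\<dots> = (L2_norm_on ?T \<phi>)\<^sup>2"
    by (simp add: L2_norm_on_def set_lebesgue_integral_def integral_nonneg_AE)
  finally have "(\<bar>p x\<bar> * sqrt (h ^ 3))\<^sup>2 \<le> (2000000 * L2_norm_on ?T \<phi>)\<^sup>2"
    using h by (simp add: e_def power_mult_distrib power_divide field_simps)
  moreover have "0 \<le> 2000000 * L2_norm_on ?T \<phi>"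
    by (simp add: L2_norm_on_def set_lebesgue_integral_def integral_nonneg_AE)
  ultimately show ?thesis
    by (rule power2_le_imp_le)
qed

text \<open>If the square of the norm of \<open>f\<close> is not integrable over the cube, its integral is \<open>0\<close> by
  convention, and the bound holds trivially.\<close>

lemma L2_norm_on_le_sup:
  fixes f :: "real^3 \<Rightarrow> 'b::real_normed_vector"
  assumes h: "0 < h" and K: "0 \<le> K" and le: "AE x in lebesgue. x \<in> cube A h \<longrightarrow> norm (f x) \<le> K"
  shows "L2_norm_on (cube A h) f \<le> K * sqrt (h ^ 3)"
proof -
  let ?T = "cube A h"
  have "(LINT x|lebesgue. indicator ?T x *\<^sub>R (norm (f x))\<^sup>2) \<le> K\<^sup>2 * h ^ 3"
  proof (cases "integrable lebesgue (\<lambda>x. indicator ?T x *\<^sub>R (norm (f x))\<^sup>2)")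
    case True
    have "(LINT x|lebesgue. indicator ?T x *\<^sub>R (norm (f x))\<^sup>2)
        \<le> (LINT x|lebesgue. indicator ?T x * K\<^sup>2)"
    proof (rule integral_mono_AE[OF True])
      show "integrable lebesgue (\<lambda>x. indicator ?T x * K\<^sup>2)"
        by (simp add: emeasure_lborel_cbox_eq)
      show "AE x in lebesgue. indicator ?T x *\<^sub>R (norm (f x))\<^sup>2 \<le> indicator ?T x * K\<^sup>2"
        using le by eventually_elim (auto simp: indicator_def intro!: power_mono)
    qed
    also have "\<dots> = K\<^sup>2 * h ^ 3"
      using measure_cube[OF h, of A] by simp
    finally show ?thesis .
  next
    case False
    then show ?thesis
      using h by (simp add: not_integrable_integral_eq)
  qed
  then have "L2_norm_on ?T f \<le> sqrt (K\<^sup>2 * h ^ 3)"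
    by (simp add: L2_norm_on_def set_lebesgue_integral_def)
  then show ?thesis
    using K by (simp add: real_sqrt_mult)
qed

text \<open>The polynomial \<open>u\<close> is the one on the side of the large part \<open>S\<close>; on the other side the gradient
  differs by the jump vector. The gradient of \<open>u\<close> contributes \<open>6 M / h\<close>, the jump at most \<open>\<sigma>\<close> times
  as much, and \<open>M\<close> is \<open>2 \<sqdot> 10\<^sup>6\<close> times the scaled norm of \<open>\<phi>\<close>. The same statement serves both
  cases of the theorem, with \<open>u\<close> the given polynomial or its extension.\<close>

lemma inverse_inequality_from_large_part:
  fixes u :: "real^3 \<Rightarrow> real"
  assumes h: "0 < h" and u: "multiaffine u" and U: "\<And>x. GDERIV u x :> U x"
    and S: "S \<in> sets lebesgue" "S \<subseteq> cube A h" "h ^ 3 / 2 \<le> measure lebesgue S"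
    and eq: "\<And>x. x \<in> S \<Longrightarrow> \<phi> x = u x"
    and int: "set_integrable lebesgue (cube A h) (\<lambda>x. (\<phi> x)\<^sup>2)"
    and F: "F \<in> cube A h" and n: "norm n = 1" and k: "\<bar>k\<bar> \<le> \<sigma>" "1 \<le> \<sigma>"
    and grad: "AE x in lebesgue. x \<in> cube A h \<longrightarrow>
      grad \<phi> x = U x \<or> grad \<phi> x = U x + (k * (U F \<bullet> n)) *\<^sub>R n"
  shows "L2_norm_on (cube A h) (grad \<phi>) \<le> 24000000 * \<sigma> * inverse h * L2_norm_on (cube A h) \<phi>"
proof -
  let ?T = "cube A h" and ?N = "L2_norm_on (cube A h) \<phi>"
  define M where "M = 2000000 * ?N / sqrt (h ^ 3)"
  have M: "\<bar>u x\<bar> \<le> M" if "x \<in> ?T" for x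
    using multiaffine_L2_lower_bound[OF u h S eq int that] h by (simp add: M_def field_simps)
  have UM: "norm (U x) \<le> 6 * M / h" if "x \<in> ?T" for x
    using norm_gradient_le[OF u h that U M] by simp
  have M0: "0 \<le> M"
    using M[OF F] by linarith
  then have base: "6 * M / h \<le> 6 * \<sigma> * M / h" "0 \<le> 6 * \<sigma> * M / h"
    using k h by (auto intro!: divide_right_mono mult_right_mono)
  have jump: "norm ((k * (U F \<bullet> n)) *\<^sub>R n) \<le> 6 * \<sigma> * M / h"
  proof -
    have "\<bar>U F \<bullet> n\<bar> \<le> 6 * M / h"
      using Cauchy_Schwarz_ineq2[of "U F" n] UM[OF F] n by simp
    then have "\<bar>k\<bar> * \<bar>U F \<bullet> n\<bar> \<le> \<sigma> * (6 * M / h)"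
      using k by (intro mult_mono) auto
    then show ?thesis
      using n by (simp add: abs_mult mult.assoc mult.left_commute)
  qed
  have "AE x in lebesgue. x \<in> ?T \<longrightarrow> norm (grad \<phi> x) \<le> 12 * \<sigma> * M / h"
    using grad
  proof eventually_elim
    case (elim x)
    show ?case
    proof
      assume x: "x \<in> ?T"
      have "norm (U x + (k * (U F \<bullet> n)) *\<^sub>R n) \<le> norm (U x) + norm ((k * (U F \<bullet> n)) *\<^sub>R n)"
        by (rule norm_triangle_ineq)
      then show "norm (grad \<phi> x) \<le> 12 * \<sigma> * M / h"
        using elim x UM[OF x] base jump
        by (smt (verit) add_divide_distrib distrib_right)
    qed
  qed
  then have "L2_norm_on ?T (grad \<phi>) \<le> 12 * \<sigma> * M / h * sqrt (h ^ 3)"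
    using h base by (intro L2_norm_on_le_sup) auto
  also have "\<dots> = 24000000 * \<sigma> * inverse h * ?N"
    using h by (simp add: M_def divide_inverse)
  finally show ?thesis .
qed

section \<open>Interface elements\<close>

text \<open>Locally the surface is the image of an open set of the plane under a differentiable map.\<close>

lemma closed_C2_surface_negligible:
  assumes "closed_C2_surface \<Gamma>"
  shows "negligible \<Gamma>"
  unfolding locally_negligible_alt[of \<Gamma>]
proof
  fix X assume "X \<in> \<Gamma>"
  then obtain U \<psi> D D2 where chart: "C2_chart \<Gamma> U \<psi> D D2" and X: "X \<in> \<psi> ` U"
    using assms unfolding closed_C2_surface_def by blast
  have "\<psi> differentiable_on U"
    using chart unfolding C2_chart_def differentiable_on_def differentiable_def
    by (meson has_derivative_at_withinI)
  then have "negligible (\<psi> ` U)"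
    by (intro negligible_differentiable_image_lowdim) auto
  then show "\<exists>V. openin (top_of_set \<Gamma>) V \<and> X \<in> V \<and> negligible V"
    using chart X unfolding C2_chart_def by blast
qed

lemma AE_cube_on_one_side:
  assumes "negligible \<Gamma>" and sep: "\<Omega>m \<union> \<Omega>p = box a b - \<Gamma>" and T: "cbox c d \<subseteq> cbox a b"
  shows "AE x in lebesgue. x \<in> cbox c d \<longrightarrow> x \<in> box c d \<inter> \<Omega>m \<or> x \<in> box c d \<inter> \<Omega>p"
proof -
  have "interior (cbox c d) \<subseteq> interior (cbox a b)"
    using T by (rule interior_mono)
  then have "box c d \<subseteq> box a b" by simp
  moreover have "negligible ((cbox c d - box c d) \<union> \<Gamma>)"
    using assms(1) by (simp add: negligible_frontier_interval)
  then have "AE x in lebesgue. x \<notin> (cbox c d - box c d) \<union> \<Gamma>"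
    by (intro AE_not_in) (simp only: negligible_iff_null_sets)
  ultimately show ?thesis
    using sep by (elim eventually_mono) blast
qed

lemma mesh_element_cube:
  assumes "cartesian_mesh a b h \<T>" "T \<in> \<T>"
  obtains A where "T = cube A h" "0 < h" "T \<subseteq> cbox a b"
proof -
  obtain k :: "3 \<Rightarrow> nat"
    where T: "T = cbox (\<chi> i. a $ i + h * real (k i)) (\<chi> i. a $ i + h * (real (k i) + 1))"
    using assms unfolding cartesian_mesh_def by blast
  have "(\<chi> i. a $ i + h * (real (k i) + 1)) = (\<chi> i. a $ i + h * real (k i)) + (\<chi> i. h)"
    by (simp add: vec_eq_iff algebra_simps)
  then have "T = cube (\<chi> i. a $ i + h * real (k i)) h"
    by (simp only: T)
  moreover have "0 < h" "T \<subseteq> cbox a b"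
    using assms unfolding cartesian_mesh_def by (auto dest: division_ofD(2))
  ultimately show thesis by (rule that)
qed

lemma centroid_in_element:
  assumes "approx_triangle \<Gamma> T P Q R" and "convex T"
  shows "centroid P Q R \<in> T"
proof -
  have "P \<in> T" "Q \<in> T" "R \<in> T"
    using assms edge_of_imp_subset unfolding approx_triangle_def intersection_points_def by blast+
  then have "(2/3) *\<^sub>R ((1/2) *\<^sub>R P + (1/2) *\<^sub>R Q) + (1/3) *\<^sub>R R \<in> T"
    using assms(2) by (intro convexD) auto
  then show ?thesis
    by (simp add: centroid_def scaleR_add_right)
qed

lemma grad_on_open_part:
  assumes "open G" "x \<in> G" "\<And>y. y \<in> G \<Longrightarrow> \<phi> y = f y" "GDERIV f x :> D"
  shows "grad \<phi> x = D"
proof (rule grad_eqI)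
  show "GDERIV \<phi> x :> D"
    using assms unfolding gderiv_def
    by (metis has_derivative_transform_within_open)
qed

text \<open>The values of \<open>\<phi>\<close> off the two sides are arbitrary, but they affect only a null set, and
  Lebesgue measure is complete. Without this integrability the integral defining the norm
  of \<open>\<phi>\<close> would be \<open>0\<close>.\<close>

lemma broken_square_integrable:
  fixes f g \<phi> :: "real^3 \<Rightarrow> real"
  assumes f: "continuous_on UNIV f" and g: "continuous_on UNIV g"
    and sides: "open \<Omega>m" "open \<Omega>p" "\<Omega>m \<inter> \<Omega>p = {}"
    and eq: "\<And>x. x \<in> cbox c d \<inter> \<Omega>m \<Longrightarrow> \<phi> x = f x" "\<And>x. x \<in> cbox c d \<inter> \<Omega>p \<Longrightarrow> \<phi> x = g x"
    and AE: "AE x in lebesgue. x \<in> cbox c d \<longrightarrow> x \<in> \<Omega>m \<union> \<Omega>p"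
  shows "set_integrable lebesgue (cbox c d) (\<lambda>x. (\<phi> x)\<^sup>2)"
proof -
  have int: "set_integrable lebesgue (cbox c d \<inter> G) (\<lambda>x. (q x)\<^sup>2)"
    if q: "continuous_on UNIV q" and G: "open G" for q :: "real^3 \<Rightarrow> real" and G
  proof (rule set_integrable_subset)
    have "continuous_on (cbox c d) (\<lambda>x. (q x)\<^sup>2)"
      using q by (intro continuous_intros) (auto intro: continuous_on_subset)
    then show "set_integrable lebesgue (cbox c d) (\<lambda>x. (q x)\<^sup>2)"
      by (rule absolutely_integrable_continuous)
  qed (use G in \<open>auto intro!: sets.Int sets_completionI_sets\<close>)
  let ?F = "\<lambda>x. indicator (cbox c d \<inter> \<Omega>m) x *\<^sub>R (f x)\<^sup>2 + indicator (cbox c d \<inter> \<Omega>p) x *\<^sub>R (g x)\<^sup>2"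
  have F: "integrable lebesgue ?F"
    using int[OF f sides(1)] int[OF g sides(2)] unfolding set_integrable_def
    by (rule Bochner_Integration.integrable_add)
  have ae: "AE x in lebesgue. ?F x = indicator (cbox c d) x *\<^sub>R (\<phi> x)\<^sup>2"
    using AE
  proof eventually_elim
    case (elim x)
    then show ?case
      using sides(3) eq by (cases "x \<in> cbox c d"; cases "x \<in> \<Omega>m"; auto simp: indicator_def)
  qed
  have "(\<lambda>x. indicator (cbox c d) x *\<^sub>R (\<phi> x)\<^sup>2) \<in> borel_measurable lebesgue"
    using F by (intro borel_measurable_AE[OF _ ae]) auto
  then show ?thesis
    unfolding set_integrable_def using F ae by (subst integrable_cong_AE[symmetric]) auto
qed

theorem theorem4p11:
  fixes a b :: "real^3" and \<Gamma> \<Omega> \<Omega>m \<Omega>p :: "(real^3) set"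
  assumes "\<Omega> = box a b" and "\<Omega> \<noteq> {}"
    and "closed_C2_surface \<Gamma>" and "\<Gamma> \<subseteq> \<Omega>"
    and "separates_into \<Gamma> \<Omega> \<Omega>m \<Omega>p"
  shows "\<exists>C>0. \<forall>h \<T> \<beta>m \<beta>p T P Q R n \<phi>.
     cartesian_mesh a b h \<T> \<longrightarrow> mesh_assumptions \<Gamma> h \<T> \<longrightarrow>
     0 < \<beta>m \<longrightarrow> \<beta>m \<le> \<beta>p \<longrightarrow>
     T \<in> \<T> \<longrightarrow> interface_element \<Gamma> \<Omega>m \<Omega>p T \<longrightarrow>
     approx_triangle \<Gamma> T P Q R \<longrightarrow> plane_unit_normal (affine hull {P, Q, R}) n \<longrightarrow>
     \<phi> \<in> ife_space \<Omega>m \<Omega>p \<beta>m \<beta>p T (centroid P Q R) n \<longrightarrow>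
     L2_norm_on T (grad \<phi>) \<le> C * (\<beta>p / \<beta>m) * inverse h * L2_norm_on T \<phi>"
proof (intro exI[of _ 24000000] conjI allI impI)
  show "(0 :: real) < 24000000" by simp
next
  fix h \<T> \<beta>m \<beta>p T P Q R n \<phi>
  assume mesh: "cartesian_mesh a b h \<T>" "T \<in> \<T>"
    and \<beta>: "0 < \<beta>m" "\<beta>m \<le> \<beta>p"
    and tri: "approx_triangle \<Gamma> T P Q R"
    and n: "plane_unit_normal (affine hull {P, Q, R}) n"
    and \<phi>: "\<phi> \<in> ife_space \<Omega>m \<Omega>p \<beta>m \<beta>p T (centroid P Q R) n"
  obtain A where T: "T = cube A h" and h: "0 < h" and "T \<subseteq> cbox a b"
    by (rule mesh_element_cube[OF mesh])
  then have Tab: "cube A h \<subseteq> cbox a b" by simp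
  let ?Q = "box A (A + (\<chi> i. h))"
  have QT: "?Q \<subseteq> cube A h" by (rule box_subset_cbox)
  define F where "F = centroid P Q R"
  have F: "F \<in> cube A h"
    using centroid_in_element[OF tri] unfolding T F_def by (simp add: convex_box)
  have n1: "norm n = 1"
    using n by (simp add: plane_unit_normal_def)
  have sides: "open \<Omega>m" "open \<Omega>p" "\<Omega>m \<inter> \<Omega>p = {}" "\<Omega>m \<union> \<Omega>p = box a b - \<Gamma>"
    using assms unfolding separates_into_def by auto
  note AE_sides = AE_cube_on_one_side[OF closed_C2_surface_negligible[OF assms(3)] sides(4) Tab]

  obtain p where "p \<in> Q1" and pm: "\<And>x. x \<in> cube A h \<inter> \<Omega>m \<Longrightarrow> \<phi> x = p x"
    and pp: "\<And>x. x \<in> cube A h \<inter> \<Omega>p \<Longrightarrow> \<phi> x = ife_extension \<beta>m \<beta>p F n p x"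
    using \<phi> unfolding ife_space_def T F_def by blast
  note Dp = Q1_GDERIV[OF \<open>p \<in> Q1\<close>] and p = Q1_multiaffine[OF \<open>p \<in> Q1\<close>]
  define k where "k = (\<beta>m / \<beta>p - 1) * (grad p F \<bullet> n)"
  define q where "q x = p x + k * ((x - F) \<bullet> n)" for x
  have qp: "\<And>x. x \<in> cube A h \<inter> \<Omega>p \<Longrightarrow> \<phi> x = q x"
    using pp by (simp add: ife_extension_def q_def k_def)
  have q: "multiaffine q"
    unfolding q_def by (rule multiaffine_affine_perturbation[OF p])
  have Dq: "GDERIV q x :> grad p x + k *\<^sub>R n" for x
    unfolding q_def by (rule gradient_of_affine_perturbation[OF Dp])

  have int: "set_integrable lebesgue (cube A h) (\<lambda>x. (\<phi> x)\<^sup>2)"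
    using p q sides pm qp AE_sides unfolding multiaffine_def
    by (intro broken_square_integrable[of p q \<Omega>m \<Omega>p]) (auto elim!: eventually_mono)
  have "AE x in lebesgue. x \<in> cube A h \<longrightarrow> grad \<phi> x = grad p x \<or> grad \<phi> x = grad p x + k *\<^sub>R n"
    using AE_sides
  proof eventually_elim
    case (elim x)
    have "grad \<phi> x = grad p x" if "x \<in> ?Q \<inter> \<Omega>m"
      by (rule grad_on_open_part[OF _ that _ Dp]) (use sides pm QT in auto)
    moreover have "grad \<phi> x = grad p x + k *\<^sub>R n" if "x \<in> ?Q \<inter> \<Omega>p"
      by (rule grad_on_open_part[OF _ that _ Dq]) (use sides qp QT in auto)
    ultimately show ?case using elim by blast
  qed
  note grad = this

  have meas: "cube A h \<inter> \<Omega>m \<in> lmeasurable" "cube A h \<inter> \<Omega>p \<in> lmeasurable"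
    using sides by (auto intro!: lmeasurable_open fmeasurable_Int_fmeasurable sets_completionI_sets)
  have "h ^ 3 \<le> measure lebesgue (cube A h \<inter> \<Omega>m) + measure lebesgue (cube A h \<inter> \<Omega>p)"
  proof -
    have "measure lebesgue (cube A h)
        = measure lebesgue ((cube A h \<inter> \<Omega>m) \<union> (cube A h \<inter> \<Omega>p))"
      using AE_sides by (intro measure_eq_AE)
        (use meas in \<open>auto elim!: eventually_mono dest: fmeasurableD\<close>)
    also have "\<dots> \<le> measure lebesgue (cube A h \<inter> \<Omega>m) + measure lebesgue (cube A h \<inter> \<Omega>p)"
      using meas by (intro measure_Un_le fmeasurableD)
    finally show ?thesis
      using measure_cube[OF h, of A] by simp
  qed
  \<comment> \<open>the polynomial of the larger part plays the role of \<open>u\<close>\<close>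
  then consider "h ^ 3 / 2 \<le> measure lebesgue (cube A h \<inter> \<Omega>m)"
    | "h ^ 3 / 2 \<le> measure lebesgue (cube A h \<inter> \<Omega>p)" by linarith
  then show "L2_norm_on T (grad \<phi>) \<le> 24000000 * (\<beta>p / \<beta>m) * inverse h * L2_norm_on T \<phi>"
    unfolding T
  proof cases
    case 1
    show "L2_norm_on (cube A h) (grad \<phi>)
        \<le> 24000000 * (\<beta>p / \<beta>m) * inverse h * L2_norm_on (cube A h) \<phi>"
    proof (rule inverse_inequality_from_large_part[OF h p Dp _ _ 1 pm int F n1])
      have "0 < \<beta>m / \<beta>p" "\<beta>m / \<beta>p \<le> 1" "1 \<le> \<beta>p / \<beta>m"
        using \<beta> by auto
      then show "\<bar>\<beta>m / \<beta>p - 1\<bar> \<le> \<beta>p / \<beta>m" "1 \<le> \<beta>p / \<beta>m"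
        by linarith+
    qed (use meas grad in \<open>auto simp: k_def dest: fmeasurableD\<close>)
  next
    case 2
    \<comment> \<open>the extension scales the normal derivative at \<open>F\<close>, so \<open>p\<close> is recovered from \<open>q\<close> by the
      inverse ratio\<close>
    have "(grad p F + k *\<^sub>R n) \<bullet> n = (grad p F \<bullet> n) * (\<beta>m / \<beta>p)"
      using n1 by (simp add: inner_add_left k_def norm_eq_1 algebra_simps)
    then have undo: "(\<beta>p / \<beta>m - 1) * ((grad p F + k *\<^sub>R n) \<bullet> n) = - k"
      using \<beta> by (simp add: k_def field_simps)
    show "L2_norm_on (cube A h) (grad \<phi>)
        \<le> 24000000 * (\<beta>p / \<beta>m) * inverse h * L2_norm_on (cube A h) \<phi>"
    proof (rule inverse_inequality_from_large_part[OF h q Dq _ _ 2 qp int F n1])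
      have "1 \<le> \<beta>p / \<beta>m"
        using \<beta> by auto
      then show "\<bar>\<beta>p / \<beta>m - 1\<bar> \<le> \<beta>p / \<beta>m" "1 \<le> \<beta>p / \<beta>m"
        by linarith+
      show "AE x in lebesgue. x \<in> cube A h \<longrightarrow> grad \<phi> x = grad p x + k *\<^sub>R n \<or>
          grad \<phi> x = grad p x + k *\<^sub>R n
            + ((\<beta>p / \<beta>m - 1) * ((grad p F + k *\<^sub>R n) \<bullet> n)) *\<^sub>R n"
        unfolding undo using grad by eventually_elim auto
    qed (use meas in \<open>auto dest: fmeasurableD\<close>)
  qed
qed

end
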